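(* Let $\mathcal{A}=(\mathcal{A}_* )^*$ be a commutative dual Banach algebra which is pointwise Connes amenable. Then $\mathcal{A}$ has an identity element.
   Context: Let $\mathcal{A}$ be a Banach algebra. A Banach $\mathcal{A}$-bimodule $E$ is dual if there is a closed submodule $E_*$ of $E^*$ (the predual of $E$) such that $E=(E_* )^*$. A Banach algebra $\mathcal{A}$ is a dual Banach algebra if it is dual as a Banach $\mathcal{A}$-bimodule; one writes $\mathcal{A}=(\mathcal{A}_* )^*$ with predual $\mathcal{A}_*$. For a dual Banach algebra $\mathcal{A}$, a dual Banach $\mathcal{A}$-bimodule $E$ is normal if the module actions of $\mathcal{A}$ on $E$ are $w^*$-continuous, i.e. for each $x\in E$ the maps $\mathcal{A}\to E$, $a\mapsto a\cdot x$ and $a\mapsto x\cdot a$, are $w^*$-$w^*$-continuous. A derivation is a bounded linear map $D:\mathcal{A}\to E$ with $D(ab)=D(a)\cdot b+a\cdot D(b)$ for all $a,b\in\mathcal{A}$. It is called $w^*$-continuous if it is $w^*$-$w^*$-continuous. A dual Banach algebra $\mathcal{A}$ is pointwise Connes amenable at $a_0\in\mathcal{A}$ if for every normal, dual Banach $\mathcal{A}$-bimodule $E$ and every $w^*$-continuous derivation $D:\mathcal{A}\to E$ there is $x\in E$ with $D(a_0)=a_0\cdot x-x\cdot a_0$. It is pointwise Connes amenable if it is pointwise Connes amenable at each $a_0\in\mathcal{A}$. *)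

theory Defs
  imports "HOL-Analysis.Analysis"
begin

text \<open>
  The scalars are a type \<open>'k\<close> of class \<open>real_normed_field\<close> and \<open>heine_borel\<close>: a field with
  multiplicative norm containing the reals, whose bounded closed sets are compact. Up to
  isomorphism these are exactly the real and the complex numbers, so that real and complex Banach
  algebras are covered at once.

  The algebra itself is a type, since it is universally quantified in the theorem. The modules
  over it are quantified over inside the definition of pointwise Connes amenability; they are
  therefore records with an explicit carrier. Throughout, \<open>smA\<close> is the scalar multiplication of
  the algebra and \<open>Apre\<close> its predual, a set of functionals.
\<close>

section \<open>Banach spaces with explicit carrier, and their duals\<close>

record ('k, 'v) nspace =
  car :: "'v set"
  zer :: 'v
  add :: "'v \<Rightarrow> 'v \<Rightarrow> 'v"
  smul :: "'k \<Rightarrow> 'v \<Rightarrow> 'v"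
  nrm :: "'v \<Rightarrow> real"

definition sub :: "('k::{real_normed_field, heine_borel}, 'v, 'z) nspace_scheme \<Rightarrow> 'v \<Rightarrow> 'v \<Rightarrow> 'v" where
  "sub E x y = add E x (smul E (- 1) y)"

locale banach_space =
  fixes E :: "('k::{real_normed_field, heine_borel}, 'v, 'z) nspace_scheme"
  assumes zer_closed: "zer E \<in> car E"
    and add_closed: "\<lbrakk>x \<in> car E; y \<in> car E\<rbrakk> \<Longrightarrow> add E x y \<in> car E"
    and smul_closed: "x \<in> car E \<Longrightarrow> smul E c x \<in> car E"
    and add_assoc: "\<lbrakk>x \<in> car E; y \<in> car E; z \<in> car E\<rbrakk>
                      \<Longrightarrow> add E (add E x y) z = add E x (add E y z)"
    and add_commute: "\<lbrakk>x \<in> car E; y \<in> car E\<rbrakk> \<Longrightarrow> add E x y = add E y x"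
    and add_zer: "x \<in> car E \<Longrightarrow> add E (zer E) x = x"
    and add_neg: "x \<in> car E \<Longrightarrow> sub E x x = zer E"
    and smul_add_right: "\<lbrakk>x \<in> car E; y \<in> car E\<rbrakk>
                      \<Longrightarrow> smul E c (add E x y) = add E (smul E c x) (smul E c y)"
    and smul_add_left: "x \<in> car E \<Longrightarrow> smul E (c + d) x = add E (smul E c x) (smul E d x)"
    and smul_smul: "x \<in> car E \<Longrightarrow> smul E c (smul E d x) = smul E (c * d) x"
    and smul_one: "x \<in> car E \<Longrightarrow> smul E 1 x = x"
    and nrm_nonneg: "x \<in> car E \<Longrightarrow> 0 \<le> nrm E x"
    and nrm_eq_0: "x \<in> car E \<Longrightarrow> nrm E x = 0 \<longleftrightarrow> x = zer E"
    and nrm_triangle: "\<lbrakk>x \<in> car E; y \<in> car E\<rbrakk> \<Longrightarrow> nrm E (add E x y) \<le> nrm E x + nrm E y"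
    and nrm_smul: "x \<in> car E \<Longrightarrow> nrm E (smul E c x) = norm c * nrm E x"
    and complete: "\<lbrakk>\<And>n. s n \<in> car E;
                    \<And>e. e > 0 \<Longrightarrow> \<exists>N. \<forall>m\<ge>N. \<forall>n\<ge>N. nrm E (sub E (s m) (s n)) < e\<rbrakk>
                      \<Longrightarrow> \<exists>l\<in>car E. (\<lambda>n::nat. nrm E (sub E (s n) l)) \<longlonglongrightarrow> 0"

text \<open>Functionals on the carrier take the value \<open>undefined\<close> outside of it, so that two of them
  are equal as soon as they agree on the carrier.\<close>

definition dual_space ::
    "('k::{real_normed_field, heine_borel}, 'v, 'z) nspace_scheme \<Rightarrow> ('k, 'v \<Rightarrow> 'k) nspace" where
  "dual_space E = \<lparr>
     car = {f \<in> extensional (car E).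
              (\<forall>x\<in>car E. \<forall>y\<in>car E. f (add E x y) = f x + f y) \<and>
              (\<forall>c. \<forall>x\<in>car E. f (smul E c x) = c * f x) \<and>
              (\<exists>C. \<forall>x\<in>car E. norm (f x) \<le> C * nrm E x)},
     zer = (\<lambda>x\<in>car E. 0),
     add = (\<lambda>f g. \<lambda>x\<in>car E. f x + g x),
     smul = (\<lambda>c f. \<lambda>x\<in>car E. c * f x),
     nrm = (\<lambda>f. Sup {norm (f x) | x. x \<in> car E \<and> nrm E x \<le> 1})\<rparr>"

definition closed_subspace :: "('k::{real_normed_field, heine_borel}, 'v, 'z) nspace_scheme \<Rightarrow> 'v set \<Rightarrow> bool" where
  "closed_subspace E P \<longleftrightarrow>
     P \<subseteq> car E \<and> zer E \<in> P \<and>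
     (\<forall>x\<in>P. \<forall>y\<in>P. add E x y \<in> P) \<and> (\<forall>c. \<forall>x\<in>P. smul E c x \<in> P) \<and>
     (\<forall>s l. (\<forall>n::nat. s n \<in> P) \<and> l \<in> car E \<and> (\<lambda>n. nrm E (sub E (s n) l)) \<longlonglongrightarrow> 0 \<longrightarrow> l \<in> P)"

text \<open>\<open>E = P\<^sup>*\<close> for a subspace \<open>P\<close> of \<open>E\<^sup>*\<close>: evaluation is an isometric isomorphism of \<open>E\<close> onto
  the dual of \<open>P\<close> (linearity of the evaluation map is automatic).\<close>

definition evaluation :: "('v \<Rightarrow> 'k) set \<Rightarrow> 'v \<Rightarrow> ('v \<Rightarrow> 'k) \<Rightarrow> 'k" where
  "evaluation P x = (\<lambda>f\<in>P. f x)"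

definition is_dual_of :: "('k::{real_normed_field, heine_borel}, 'v, 'z) nspace_scheme \<Rightarrow> ('v \<Rightarrow> 'k) set \<Rightarrow> bool" where
  "is_dual_of E P \<longleftrightarrow>
     (let P' = dual_space ((dual_space E)\<lparr>car := P\<rparr>)
      in bij_betw (evaluation P) (car E) (car P') \<and>
         (\<forall>x\<in>car E. nrm P' (evaluation P x) = nrm E x))"

text \<open>The topology \<open>\<sigma>(E, P)\<close>: the coarsest one on the carrier making all members of \<open>P\<close>
  continuous.\<close>

definition wstar :: "('k::{real_normed_field, heine_borel}, 'v, 'z) nspace_scheme \<Rightarrow> ('v \<Rightarrow> 'k) set \<Rightarrow> 'v topology" where
  "wstar E P = pullback_topology (car E) (evaluation P) (product_topology (\<lambda>_. euclidean) P)"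

section \<open>Banach algebras and bimodules\<close>

locale banach_algebra = vector_space smA
  for smA :: "'k::{real_normed_field, heine_borel} \<Rightarrow> 'a::{real_normed_algebra, banach} \<Rightarrow> 'a" +
  assumes scale_of_real: "smA (of_real r) x = r *\<^sub>R x"
    and norm_scale: "norm (smA c x) = norm c * norm x"
    and scale_mult_left: "smA c x * y = smA c (x * y)"
    and scale_mult_right: "x * smA c y = smA c (x * y)"

record ('k, 'a, 'v) bimodule = "('k, 'v) nspace" +
  lact :: "'a \<Rightarrow> 'v \<Rightarrow> 'v"
  ract :: "'v \<Rightarrow> 'a \<Rightarrow> 'v"

locale banach_bimodule = A: banach_algebra smA + banach_space E
  for smA :: "'k::{real_normed_field, heine_borel} \<Rightarrow> 'a::{real_normed_algebra, banach} \<Rightarrow> 'a"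
    and E :: "('k, 'a, 'v) bimodule" +
  assumes lact_closed: "x \<in> car E \<Longrightarrow> lact E a x \<in> car E"
    and ract_closed: "x \<in> car E \<Longrightarrow> ract E x a \<in> car E"
    and lact_add: "\<lbrakk>x \<in> car E; y \<in> car E\<rbrakk>
                     \<Longrightarrow> lact E a (add E x y) = add E (lact E a x) (lact E a y)"
    and lact_smul: "x \<in> car E \<Longrightarrow> lact E a (smul E c x) = smul E c (lact E a x)"
    and add_lact: "x \<in> car E \<Longrightarrow> lact E (a + b) x = add E (lact E a x) (lact E b x)"
    and scale_lact: "x \<in> car E \<Longrightarrow> lact E (smA c a) x = smul E c (lact E a x)"
    and ract_add: "\<lbrakk>x \<in> car E; y \<in> car E\<rbrakk>
                     \<Longrightarrow> ract E (add E x y) a = add E (ract E x a) (ract E y a)"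
    and ract_smul: "x \<in> car E \<Longrightarrow> ract E (smul E c x) a = smul E c (ract E x a)"
    and add_ract: "x \<in> car E \<Longrightarrow> ract E x (a + b) = add E (ract E x a) (ract E x b)"
    and scale_ract: "x \<in> car E \<Longrightarrow> ract E x (smA c a) = smul E c (ract E x a)"
    and lact_mult: "x \<in> car E \<Longrightarrow> lact E (a * b) x = lact E a (lact E b x)"
    and ract_mult: "x \<in> car E \<Longrightarrow> ract E x (a * b) = ract E (ract E x a) b"
    and lact_ract: "x \<in> car E \<Longrightarrow> ract E (lact E a x) b = lact E a (ract E x b)"
    and bounded: "\<exists>C. \<forall>a. \<forall>x\<in>car E. nrm E (lact E a x) \<le> C * norm a * nrm E x \<and>
                                       nrm E (ract E x a) \<le> C * norm a * nrm E x"

text \<open>The canonical actions on \<open>E\<^sup>*\<close> are \<open>(a \<cdot> f) x = f (x \<cdot> a)\<close> and \<open>(f \<cdot> a) x = f (a \<cdot> x)\<close>.\<close>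

definition dual_lact :: "('k, 'a, 'v) bimodule \<Rightarrow> 'a \<Rightarrow> ('v \<Rightarrow> 'k) \<Rightarrow> 'v \<Rightarrow> 'k" where
  "dual_lact E a f = (\<lambda>x\<in>car E. f (ract E x a))"

definition dual_ract :: "('k, 'a, 'v) bimodule \<Rightarrow> ('v \<Rightarrow> 'k) \<Rightarrow> 'a \<Rightarrow> 'v \<Rightarrow> 'k" where
  "dual_ract E f a = (\<lambda>x\<in>car E. f (lact E a x))"

locale dual_banach_bimodule = banach_bimodule smA E
  for smA :: "'k::{real_normed_field, heine_borel} \<Rightarrow> 'a::{real_normed_algebra, banach} \<Rightarrow> 'a"
    and E :: "('k, 'a, 'v) bimodule" +
  fixes P :: "('v \<Rightarrow> 'k) set"
  assumes predual_closed_subspace: "closed_subspace (dual_space E) P"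
    and predual_lact: "f \<in> P \<Longrightarrow> dual_lact E a f \<in> P"
    and predual_ract: "f \<in> P \<Longrightarrow> dual_ract E f a \<in> P"
    and is_dual: "is_dual_of E P"

definition self_bimodule ::
    "('k \<Rightarrow> 'a \<Rightarrow> 'a) \<Rightarrow> ('k, 'a::real_normed_algebra, 'a) bimodule" where
  "self_bimodule smA = \<lparr>car = UNIV, zer = 0, add = (+), smul = smA, nrm = norm,
                          lact = (*), ract = (*)\<rparr>"

definition dual_banach_algebra ::
    "('k::{real_normed_field, heine_borel} \<Rightarrow> 'a::{real_normed_algebra, banach} \<Rightarrow> 'a) \<Rightarrow> ('a \<Rightarrow> 'k) set \<Rightarrow> bool" where
  "dual_banach_algebra smA Apre \<longleftrightarrow> dual_banach_bimodule smA (self_bimodule smA) Apre"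

section \<open>Pointwise Connes amenability\<close>

definition wstar_continuous ::
    "('k::{real_normed_field, heine_borel} \<Rightarrow> 'a::{real_normed_algebra, banach} \<Rightarrow> 'a) \<Rightarrow> ('a \<Rightarrow> 'k) set \<Rightarrow>
     ('k, 'a, 'v) bimodule \<Rightarrow> ('v \<Rightarrow> 'k) set \<Rightarrow> ('a \<Rightarrow> 'v) \<Rightarrow> bool" where
  "wstar_continuous smA Apre E P T \<longleftrightarrow> continuous_map (wstar (self_bimodule smA) Apre) (wstar E P) T"

definition normal_dual_banach_bimodule ::
    "('k::{real_normed_field, heine_borel} \<Rightarrow> 'a::{real_normed_algebra, banach} \<Rightarrow> 'a) \<Rightarrow> ('a \<Rightarrow> 'k) set \<Rightarrow>
     ('k, 'a, 'v) bimodule \<Rightarrow> ('v \<Rightarrow> 'k) set \<Rightarrow> bool" where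
  "normal_dual_banach_bimodule smA Apre E P \<longleftrightarrow>
     dual_banach_bimodule smA E P \<and>
     (\<forall>x\<in>car E. wstar_continuous smA Apre E P (\<lambda>a. lact E a x) \<and>
                wstar_continuous smA Apre E P (\<lambda>a. ract E x a))"

definition derivation ::
    "('k \<Rightarrow> 'a \<Rightarrow> 'a) \<Rightarrow> ('k, 'a::real_normed_algebra, 'v) bimodule \<Rightarrow> ('a \<Rightarrow> 'v) \<Rightarrow> bool" where
  "derivation smA E D \<longleftrightarrow>
     (\<forall>a. D a \<in> car E) \<and>
     (\<forall>a b. D (a + b) = add E (D a) (D b)) \<and>
     (\<forall>c a. D (smA c a) = smul E c (D a)) \<and>
     (\<exists>C. \<forall>a. nrm E (D a) \<le> C * norm a) \<and>
     (\<forall>a b. D (a * b) = add E (ract E (D a) b) (lact E a (D b)))"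

text \<open>
  The carriers of the modules range over the subsets of the type \<open>'a set set\<close>, as HOL does not
  allow quantification over all types. This is no restriction. Given an arbitrary normal dual
  bimodule \<open>E\<close> with predual \<open>P\<close> and a weak-star continuous derivation \<open>D\<close> into it, let \<open>F\<close> be the
  weak-star closure of the sub-bimodule \<open>S\<close> of \<open>E\<close> generated by the range of \<open>D\<close>. Then \<open>F\<close>, with
  the restrictions of the members of \<open>P\<close> as predual, is again a normal dual bimodule, and a
  solution \<open>x\<close> in \<open>F\<close> is also one in \<open>E\<close>. If \<open>'a\<close> is nonzero, \<open>S\<close> has at most the cardinality of
  \<open>'a\<close>; and every point of \<open>F\<close> is the limit of an ultrafilter on \<open>S\<close>, so that \<open>F\<close> can be
  transported to a subset of \<open>'a set set\<close>. If \<open>'a\<close> is zero, so is \<open>D\<close>.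
\<close>

definition pointwise_Connes_amenable_at ::
    "('k::{real_normed_field, heine_borel} \<Rightarrow> 'a::{real_normed_algebra, banach} \<Rightarrow> 'a) \<Rightarrow> ('a \<Rightarrow> 'k) set \<Rightarrow> 'a \<Rightarrow> bool" where
  "pointwise_Connes_amenable_at smA Apre a0 \<longleftrightarrow>
     (\<forall>(E :: ('k, 'a, 'a set set) bimodule) P D.
        normal_dual_banach_bimodule smA Apre E P \<and> derivation smA E D \<and>
        wstar_continuous smA Apre E P D \<longrightarrow>
        (\<exists>x\<in>car E. D a0 = sub E (lact E a0 x) (ract E x a0)))"

definition pointwise_Connes_amenable ::
    "('k::{real_normed_field, heine_borel} \<Rightarrow> 'a::{real_normed_algebra, banach} \<Rightarrow> 'a) \<Rightarrow> ('a \<Rightarrow> 'k) set \<Rightarrow> bool" where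
  "pointwise_Connes_amenable smA Apre \<longleftrightarrow> (\<forall>a0. pointwise_Connes_amenable_at smA Apre a0)"

end

theory Submission
  imports Defs
begin

text \<open>
  Let the algebra act on itself by multiplication from the left and by zero from the right. This
  is a normal dual bimodule, for which the identity map is a weak-star continuous derivation.
  Pointwise Connes amenability at \<open>a\<close> therefore yields an \<open>x\<close> with \<open>a = a x\<close>: every single element
  has a unit (lemma \<open>pointwise_Connes_amenable_at_imp_unit\<close>).

  These local units depend on \<open>a\<close> and come without a bound. The Baire category theorem supplies one:
  on some ball, approximate units of norm at most some \<open>n\<close> exist, and in a commutative algebra the
  identity \<open>1 - (u + v - u v) = (1 - u) (1 - v)\<close> carries this bound, enlarged to \<open>2 n + n\<^sup>2\<close>, from
  the ball to all elements (\<open>uniformly_approx_unital\<close>). The same identity gives each finite set an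
  exact joint unit \<open>e\<close>, and a bounded approximate unit of that one element \<open>e\<close> is a bounded
  approximate unit of the whole finite set (\<open>bounded_approximate_joint_unit\<close>).

  Balls of the algebra are weak-star compact by the Banach-Alaoglu theorem
  (\<open>compactin_wstar_ball\<close>), and multiplication is separately weak-star continuous. A weak-star
  cluster point of the bounded approximate units, indexed by the finite sets and the precisions, is
  therefore an identity element (\<open>identity_from_bounded_approximate_joint_units\<close>).

  The definition of pointwise Connes amenability quantifies over modules whose elements are sets of
  sets of elements of the algebra. The algebra is thus first replaced by an isometric copy of that
  kind; the necessary invariance of duals, preduals and weak-star continuity under isometric
  isomorphism is what leads to \<open>pointwise_Connes_amenable_atD\<close>.
\<close>

section \<open>Bounded approximate units in commutative Banach algebras\<close>

text \<open>
  In the unitization \<open>(1 - e) (1 - d) = 1 - (e + d - e d)\<close>, and by commutativity this product is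
  killed by everything that \<open>1 - e\<close> or \<open>1 - d\<close> kills. The norms grow with the number of factors,
  so that no bound uniform in \<open>S\<close> comes out of this.
\<close>

lemma finite_joint_unit:
  fixes S :: "'a::ring set"
  assumes comm: "\<And>a b :: 'a. a * b = b * a"
    and units: "\<And>a :: 'a. \<exists>e. a * e = a"
    and "finite S"
  shows "\<exists>e. \<forall>a\<in>S. a * e = a"
  using \<open>finite S\<close>
proof induction
  case (insert b S)
  obtain e where e: "\<forall>a\<in>S. a * e = a" using insert.IH by blast
  obtain d where d: "b * d = b" using units by blast
  have "b * (e * d) = b * e" by (metis comm d mult.assoc)
  then have "b * (e + d - e * d) = b" using d by (simp add: algebra_simps)
  moreover have "a * (e + d - e * d) = a" if "a \<in> S" for a
  proof -
    have "a * (e * d) = a * d" by (metis e mult.assoc that)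
    then show ?thesis using e that by (simp add: algebra_simps)
  qed
  ultimately show ?case by blast
qed simp

text \<open>
  Approximate instead of exact units make this set closed, as the Baire category theorem
  demands.
\<close>

definition approx_unital :: "real \<Rightarrow> 'a::real_normed_algebra set" where
  "approx_unital r = {a. \<forall>\<epsilon>>0. \<exists>u. norm u \<le> r \<and> norm (a * u - a) < \<epsilon>}"

lemma closed_approx_unital:
  assumes "0 \<le> r"
  shows "closed (approx_unital r :: 'a::real_normed_algebra set)"
proof -
  have "a \<in> approx_unital r" if a: "a \<in> closure (approx_unital r)" for a :: 'a
    unfolding approx_unital_def
  proof (clarify)
    fix \<epsilon> :: real assume "\<epsilon> > 0"
    define \<delta> where "\<delta> = \<epsilon> / (2 * (r + 1))"
    have "\<delta> > 0" using \<open>\<epsilon> > 0\<close> assms by (simp add: \<delta>_def)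
    then obtain b where b: "b \<in> approx_unital r" "dist b a < \<delta>"
      using a closure_approachable by blast
    then obtain u where u: "norm u \<le> r" "norm (b * u - b) < \<epsilon> / 2"
      unfolding approx_unital_def using \<open>\<epsilon> > 0\<close> half_gt_zero by blast
    have "norm ((a - b) * u) \<le> \<delta> * r"
      by (rule order_trans[OF norm_mult_ineq], rule mult_mono)
         (use b u \<open>\<delta> > 0\<close> in \<open>auto simp: dist_norm norm_minus_commute\<close>)
    moreover have "a * u - a = (a - b) * u + (b * u - b) + (b - a)" by (simp add: algebra_simps)
    then have "norm (a * u - a) \<le> norm ((a - b) * u) + norm (b * u - b) + norm (b - a)"
      using norm_triangle_ineq[of "(a - b) * u + (b * u - b)" "b - a"]
        norm_triangle_ineq[of "(a - b) * u" "b * u - b"] by simp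
    ultimately have "norm (a * u - a) < \<delta> * r + \<epsilon> / 2 + \<delta>"
      using u b by (simp add: dist_norm)
    also have "\<dots> = \<delta> * (r + 1) + \<epsilon> / 2" by (simp add: algebra_simps)
    also have "\<delta> * (r + 1) = \<epsilon> / 2" using assms by (simp add: \<delta>_def divide_simps)
    finally have "norm (a * u - a) < \<epsilon>" by simp
    then show "\<exists>u. norm u \<le> r \<and> norm (a * u - a) < \<epsilon>" using u by blast
  qed
  then show ?thesis by (meson closure_subset_eq subsetI)
qed

text \<open>
  The sets \<open>approx_unital n\<close> cover the algebra, so by Baire one of them contains a ball around some
  \<open>c\<close>. After rescaling \<open>b\<close>, the elements \<open>c\<close> and \<open>c + b\<close> both lie in this ball and have
  approximate units \<open>v\<close> and \<open>u\<close> of norm at most \<open>n\<close>. In the unitization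
  \<open>b (1 - u) (1 - v) = ((c + b) (1 - u)) (1 - v) - (c (1 - v)) (1 - u)\<close>, where commutativity
  enters in the last product, is small. Hence \<open>u + v - u v\<close>, of norm at most \<open>2 n + n\<^sup>2\<close>, is an
  approximate unit for \<open>b\<close>.
\<close>

lemma uniformly_approx_unital:
  assumes comm: "\<And>a b :: 'a::{real_normed_algebra, banach}. a * b = b * a"
    and units: "\<And>a :: 'a. \<exists>e. a * e = a"
  shows "\<exists>r. approx_unital r = (UNIV :: 'a set)"
proof -
  let ?A = "\<lambda>n. approx_unital (real n) :: 'a set"
  have "(\<Union>n. ?A n) = UNIV"
  proof -
    have "\<exists>n. a \<in> ?A n" for a
    proof -
      obtain e where "a * e = a" using units by blast
      moreover obtain n where "norm e \<le> real n" using real_arch_simple by blast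
      ultimately have "a \<in> ?A n" unfolding approx_unital_def by (auto intro!: exI[of _ e])
      then show ?thesis ..
    qed
    then show ?thesis by blast
  qed
  then have "\<exists>n. interior (?A n) \<noteq> {}"
    using Baire_category_alt[of "euclidean :: 'a topology" "range ?A"]
      completely_metrizable_space_euclidean[where 'a='a]
    by (force simp: closed_approx_unital)
  then obtain n c where "c \<in> interior (?A n)" by blast
  then obtain r where "r > 0" and r: "ball c r \<subseteq> ?A n"
    using mem_interior by blast
  define m where "m = real n"
  have m: "m \<ge> 0" by (simp add: m_def)
  have "b \<in> approx_unital (2 * m + m * m)" for b :: 'a
    unfolding approx_unital_def
  proof clarify
    fix \<epsilon> :: real assume "\<epsilon> > 0"
    \<comment> \<open>\<open>t\<close> rescales \<open>b\<close> into the ball of radius \<open>r\<close>; \<open>\<eta>\<close> is the precision that makes the two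
        error terms, each at most \<open>\<eta> (1 + m)\<close>, add up to \<open>t \<epsilon> / 2\<close>.\<close>
    define t where "t = r / (2 * (norm b + 1))"
    have "t > 0" using \<open>r > 0\<close> by (simp add: t_def add_nonneg_pos)
    have "norm (t *\<^sub>R b) = r / 2 * (norm b / (norm b + 1))"
      using \<open>r > 0\<close> by (simp add: t_def)
    also have "\<dots> < r"
    proof -
      have "norm b / (norm b + 1) \<le> 1" by (simp add: divide_le_eq add_nonneg_pos)
      then have "r / 2 * (norm b / (norm b + 1)) \<le> r / 2 * 1"
        using \<open>r > 0\<close> by (intro mult_left_mono) auto
      then show ?thesis using \<open>r > 0\<close> by linarith
    qed
    finally have mem: "c + t *\<^sub>R b \<in> ?A n" "c \<in> ?A n"
      using r \<open>r > 0\<close> by (auto simp: dist_norm)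
    define \<eta> where "\<eta> = \<epsilon> * t / (4 * (1 + m))"
    have "\<eta> > 0" using \<open>\<epsilon> > 0\<close> \<open>t > 0\<close> m by (simp add: \<eta>_def)
    obtain u where u: "norm u \<le> m" "norm ((c + t *\<^sub>R b) * u - (c + t *\<^sub>R b)) < \<eta>"
      using mem(1) \<open>\<eta> > 0\<close> by (auto simp: approx_unital_def m_def)
    obtain v where v: "norm v \<le> m" "norm (c * v - c) < \<eta>"
      using mem(2) \<open>\<eta> > 0\<close> by (auto simp: approx_unital_def m_def)
    define p q where "p = (c + t *\<^sub>R b) * u - (c + t *\<^sub>R b)" and "q = c * v - c"
    define w where "w = u + v - u * v"
    have "c * (v * u) = c * (u * v)" by (simp add: comm[of v u])
    then have eq: "t *\<^sub>R (b * w - b) = p - p * v - q + q * u"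
      by (simp add: p_def q_def w_def algebra_simps)
    have "norm (p - p * v - q + q * u) \<le> norm p + norm (p * v) + norm q + norm (q * u)"
      using norm_triangle_ineq[of "p - p * v - q" "q * u"] norm_triangle_ineq4[of "p - p * v" q]
        norm_triangle_ineq4[of p "p * v"] by simp
    also have "norm (p * v) \<le> \<eta> * m"
      by (rule order_trans[OF norm_mult_ineq], rule mult_mono)
         (use u v m \<open>\<eta> > 0\<close> in \<open>auto simp: p_def\<close>)
    also have "norm (q * u) \<le> \<eta> * m"
      by (rule order_trans[OF norm_mult_ineq], rule mult_mono)
         (use u v m \<open>\<eta> > 0\<close> in \<open>auto simp: q_def\<close>)
    also have "norm p + \<eta> * m + norm q + \<eta> * m < 2 * \<eta> * (1 + m)"
      using u(2)[folded p_def] v(2)[folded q_def] by (simp add: algebra_simps)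
    also have "norm (p - p * v - q + q * u) = t * norm (b * w - b)"
      using \<open>t > 0\<close> by (simp flip: eq)
    finally have "t * norm (b * w - b) < 2 * \<eta> * (1 + m)" by simp
    also have "\<dots> = t * (\<epsilon> / 2)" using m by (simp add: \<eta>_def field_simps)
    finally have "norm (b * w - b) < \<epsilon>" using \<open>t > 0\<close> \<open>\<epsilon> > 0\<close> by simp
    moreover have "norm w \<le> 2 * m + m * m"
    proof -
      have "norm w \<le> norm u + norm v + norm (u * v)"
        unfolding w_def using norm_triangle_ineq4[of "u + v" "u * v"] norm_triangle_ineq[of u v] by simp
      moreover have "norm (u * v) \<le> m * m"
        by (rule order_trans[OF norm_mult_ineq], rule mult_mono) (use u v m in auto)
      ultimately show ?thesis using u v by simp
    qed
    ultimately show "\<exists>u. norm u \<le> 2 * m + m * m \<and> norm (b * u - b) < \<epsilon>" by blast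
  qed
  then show ?thesis by blast
qed

text \<open>
  A bounded approximate unit \<open>u\<close> for one exact joint unit \<open>e\<close> of \<open>S\<close> serves all of \<open>S\<close>, because
  \<open>a u - a = a (e u - e)\<close> for \<open>a \<in> S\<close>. The bound is thus the one for single elements, whatever the size
  of \<open>S\<close>.
\<close>

lemma bounded_approximate_joint_unit:
  assumes comm: "\<And>a b :: 'a::{real_normed_algebra, banach}. a * b = b * a"
    and units: "\<And>a :: 'a. \<exists>e. a * e = a"
  obtains r where "0 < r"
    and "\<And>S \<delta>. \<lbrakk>finite (S :: 'a set); \<delta> > 0\<rbrakk> \<Longrightarrow> \<exists>u. norm u \<le> r \<and> (\<forall>a\<in>S. norm (a * u - a) < \<delta>)"
proof -
  obtain r where r: "approx_unital r = (UNIV :: 'a set)"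
    using uniformly_approx_unital[OF comm units] by blast
  have "(0 :: 'a) \<in> approx_unital r" using r by simp
  then obtain u :: 'a where "norm u \<le> r" unfolding approx_unital_def using zero_less_one by blast
  then have "r \<ge> 0" using norm_ge_zero order_trans by blast
  \<comment> \<open>\<open>r\<close> can be \<open>0\<close>, hence \<open>r + 1\<close> as a positive bound.\<close>
  have "\<exists>u. norm u \<le> r + 1 \<and> (\<forall>a\<in>S. norm (a * u - a) < \<delta>)"
    if "finite S" "\<delta> > 0" for S :: "'a set" and \<delta>
  proof -
    obtain e where e: "\<forall>a\<in>S. a * e = a" using finite_joint_unit[OF comm units \<open>finite S\<close>] by blast
    define C where "C = (\<Sum>a\<in>S. norm a) + 1"
    have C: "norm a \<le> C" if "a \<in> S" for a
      using member_le_sum[OF that, of norm] \<open>finite S\<close> by (simp add: C_def)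
    have "C > 0" unfolding C_def by (simp add: add_nonneg_pos sum_nonneg)
    have "e \<in> approx_unital r" using r by blast
    then obtain u where u: "norm u \<le> r" "norm (e * u - e) < \<delta> / C"
      using \<open>\<delta> > 0\<close> \<open>C > 0\<close> unfolding approx_unital_def using divide_pos_pos by blast
    have "norm (a * u - a) < \<delta>" if "a \<in> S" for a
    proof -
      have "a * u - a = a * (e * u - e)"
        using e that by (simp add: right_diff_distrib mult.assoc[symmetric])
      then have "norm (a * u - a) \<le> norm a * norm (e * u - e)" by (simp add: norm_mult_ineq)
      also have "\<dots> \<le> C * norm (e * u - e)" using C[OF that] by (simp add: mult_right_mono)
      also have "\<dots> < \<delta>" using u(2) \<open>C > 0\<close> by (simp add: field_simps)
      finally show ?thesis .
    qed
    then show ?thesis using u by (intro exI[of _ u]) auto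
  qed
  then show thesis using that[of "r + 1"] \<open>r \<ge> 0\<close> by fastforce
qed

section \<open>The weak-star topology and the Banach-Alaoglu theorem\<close>

lemma compactin_pullback_topology:
  assumes "compactin T (f ` S)" "S \<subseteq> A"
  shows "compactin (pullback_topology A f T) S"
  unfolding compactin_def
proof (intro conjI allI impI)
  show "S \<subseteq> topspace (pullback_topology A f T)"
    using assms compactin_subset_topspace by (fastforce simp: topspace_pullback_topology)
next
  fix \<U> assume \<U>: "(\<forall>U\<in>\<U>. openin (pullback_topology A f T) U) \<and> S \<subseteq> \<Union>\<U>"
  then have "\<forall>U\<in>\<U>. \<exists>V. openin T V \<and> U = f -` V \<inter> A"
    by (simp add: openin_pullback_topology)
  then obtain V where V: "\<And>U. U \<in> \<U> \<Longrightarrow> openin T (V U) \<and> U = f -` V U \<inter> A"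
    by metis
  have "f ` S \<subseteq> \<Union>(V ` \<U>)" using \<U> V by blast
  then obtain \<F> where "finite \<F>" "\<F> \<subseteq> V ` \<U>" and F: "f ` S \<subseteq> \<Union>\<F>"
    using assms(1) V unfolding compactin_def by (metis (no_types, lifting) image_iff)
  then obtain \<G> where \<G>: "finite \<G>" "\<G> \<subseteq> \<U>" "\<F> = V ` \<G>"
    by (metis finite_subset_image)
  have "S \<subseteq> \<Union>\<G>"
  proof
    fix x assume "x \<in> S"
    then obtain U where "U \<in> \<G>" "f x \<in> V U" using F \<G> by blast
    then show "x \<in> \<Union>\<G>" using V \<G> \<open>x \<in> S\<close> assms(2) by blast
  qed
  then show "\<exists>\<F>. finite \<F> \<and> \<F> \<subseteq> \<U> \<and> S \<subseteq> \<Union>\<F>" using \<G> by blast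
qed

lemma topspace_wstar [simp]: "topspace (wstar E P) = car E"
  by (auto simp: wstar_def topspace_pullback_topology evaluation_def)

lemma continuous_map_wstar_functional:
  assumes "f \<in> P"
  shows "continuous_map (wstar E P) euclidean f"
proof -
  have "(\<lambda>g. g f) \<circ> evaluation P = f"
    using assms by (auto simp: evaluation_def)
  moreover have "continuous_map (wstar E P) euclidean ((\<lambda>g. g f) \<circ> evaluation P)"
    unfolding wstar_def using assms
    by (intro continuous_map_pullback continuous_map_product_projection)
  ultimately show ?thesis by simp
qed

text \<open>
  The universal property of the initial topology: weak-star continuity of a map into a module can be
  tested on the functionals of the predual one at a time.
\<close>

lemma continuous_map_into_wstar_iff:
  "continuous_map X (wstar E P) T \<longleftrightarrow>
     T ` topspace X \<subseteq> car E \<and> (\<forall>f\<in>P. continuous_map X euclidean (\<lambda>x. f (T x)))"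
  (is "?L \<longleftrightarrow> ?R")
proof
  assume L: ?L
  then have "T ` topspace X \<subseteq> car E" by (metis continuous_map_image_subset_topspace topspace_wstar)
  moreover have "continuous_map X euclidean (\<lambda>x. f (T x))" if "f \<in> P" for f
    using continuous_map_compose[OF L continuous_map_wstar_functional[OF that]] by (simp add: comp_def)
  ultimately show ?R by blast
next
  assume R: ?R
  show ?L unfolding wstar_def
  proof (rule continuous_map_pullback')
    show "continuous_map X (product_topology (\<lambda>_. euclidean) P) (evaluation P \<circ> T)"
      using R by (auto simp: continuous_map_componentwise evaluation_def)
    show "topspace X \<subseteq> T -` car E" using R by blast
  qed
qed

lemma dual_space_sel:
  "car (dual_space E) = {f \<in> extensional (car E).
              (\<forall>x\<in>car E. \<forall>y\<in>car E. f (add E x y) = f x + f y) \<and>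
              (\<forall>c. \<forall>x\<in>car E. f (smul E c x) = c * f x) \<and>
              (\<exists>C. \<forall>x\<in>car E. norm (f x) \<le> C * nrm E x)}"
  "zer (dual_space E) = (\<lambda>x\<in>car E. 0)"
  "add (dual_space E) f g = (\<lambda>x\<in>car E. f x + g x)"
  "smul (dual_space E) c f = (\<lambda>x\<in>car E. c * f x)"
  "nrm (dual_space E) f = Sup {norm (f x) | x. x \<in> car E \<and> nrm E x \<le> 1}"
  by (simp_all add: dual_space_def)

lemma (in banach_space) norm_functional_le:
  assumes f: "f \<in> car (dual_space E)" and x: "x \<in> car E" "nrm E x \<le> M" and "0 < M"
  shows "norm (f x) \<le> M * nrm (dual_space E) f"
proof -
  let ?c = "of_real (1 / M) :: 'k"
  obtain C where "\<forall>y\<in>car E. norm (f y) \<le> C * nrm E y"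
    using f by (auto simp: dual_space_sel)
  then have C: "norm (f y) \<le> C * nrm E y" if "y \<in> car E" for y using that by blast
  have "bdd_above {norm (f x) | x. x \<in> car E \<and> nrm E x \<le> 1}"
  proof (rule bdd_aboveI[of _ "\<bar>C\<bar>"], clarify)
    fix y assume y: "y \<in> car E" "nrm E y \<le> 1"
    have "C * nrm E y \<le> \<bar>C\<bar> * 1" using y nrm_nonneg by (intro mult_mono) auto
    then show "norm (f y) \<le> \<bar>C\<bar>" using C[OF y(1)] by simp
  qed
  moreover have "smul E ?c x \<in> car E" using x smul_closed by simp
  moreover have "nrm E (smul E ?c x) \<le> 1"
    using x \<open>0 < M\<close> by (simp add: nrm_smul field_simps norm_divide)
  ultimately have "norm (f (smul E ?c x)) \<le> nrm (dual_space E) f"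
    unfolding dual_space_sel by (intro cSup_upper) auto
  moreover have "norm (f (smul E ?c x)) = norm (f x) / M"
    using f x \<open>0 < M\<close> by (simp add: dual_space_sel norm_mult norm_divide)
  ultimately show ?thesis using \<open>0 < M\<close>
    by (metis divide_le_eq mult.commute)
qed

lemma continuous_map_mult_left:
  fixes f :: "'a \<Rightarrow> 'b::real_normed_algebra"
  shows "continuous_map X euclidean f \<Longrightarrow> continuous_map X euclidean (\<lambda>x. c * f x)"
  by (simp add: continuous_map_atin tendsto_mult)

text \<open>
  The Banach-Alaoglu theorem. Evaluation identifies the ball with the linear functionals on \<open>P\<close>
  bounded by \<open>M\<close>; inside the compact product of the discs of radius \<open>M * \<parallel>f\<parallel>\<close> these are cut out by
  the closed conditions of additivity (\<open>A\<close> below) and homogeneity (\<open>H\<close>). That every functional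
  satisfying them comes from a point of \<open>E\<close>, and from one of norm at most \<open>M\<close>, is the duality
  \<open>E = P\<^sup>*\<close>.
\<close>

lemma (in banach_space) compactin_wstar_ball:
  assumes P: "closed_subspace (dual_space E) P" and dual: "is_dual_of E P" and M: "0 < M"
  shows "compactin (wstar E P) {x \<in> car E. nrm E x \<le> M}"
proof -
  let ?E' = "dual_space E"
  let ?P' = "dual_space (?E'\<lparr>car := P\<rparr>)"
  let ?X = "product_topology (\<lambda>_. euclidean) P :: (('v \<Rightarrow> 'k) \<Rightarrow> 'k) topology"
  let ?B = "{x \<in> car E. nrm E x \<le> M}"
  let ?box = "\<Pi>\<^sub>E f\<in>P. cball 0 (M * nrm ?E' f)"
  define A where "A = (\<Inter>f\<in>P. \<Inter>h\<in>P. {g \<in> topspace ?X. g (add ?E' f h) - (g f + g h) \<in> {0}})"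
  define H where "H = (\<Inter>c. \<Inter>f\<in>P. {g \<in> topspace ?X. g (smul ?E' c f) - c * g f \<in> {0}})"
  have subspace: "P \<subseteq> car ?E'" "zer ?E' \<in> P" "\<And>f h. \<lbrakk>f \<in> P; h \<in> P\<rbrakk> \<Longrightarrow> add ?E' f h \<in> P"
    "\<And>c f. f \<in> P \<Longrightarrow> smul ?E' c f \<in> P"
    using P by (auto simp: closed_subspace_def)
  have "P \<noteq> {}" using subspace(2) by blast
  have "closedin ?X A" unfolding A_def using \<open>P \<noteq> {}\<close>
    by (intro closedin_INT closedin_continuous_map_preimage[where Y = euclidean] continuous_map_diff continuous_map_add
          continuous_map_product_projection subspace) auto
  moreover have "closedin ?X H" unfolding H_def using \<open>P \<noteq> {}\<close>
    by (intro closedin_INT closedin_continuous_map_preimage[where Y = euclidean] continuous_map_diff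
          continuous_map_mult_left
          continuous_map_product_projection subspace) auto
  moreover have "compactin ?X ?box" by (simp add: compactin_PiE)
  ultimately have "compactin ?X (A \<inter> (H \<inter> ?box))" by (intro closed_Int_compactin)
  moreover have "A \<inter> (H \<inter> ?box) = evaluation P ` ?B"
  proof (intro equalityI subsetI)
    fix g assume "g \<in> evaluation P ` ?B"
    then obtain x where x: "x \<in> car E" "nrm E x \<le> M" and g: "g = evaluation P x" by blast
    have "norm (f x) \<le> M * nrm ?E' f" if "f \<in> P" for f
      using norm_functional_le x M subspace(1) that by blast
    then have "g \<in> ?box" by (simp add: g evaluation_def)
    moreover have "g \<in> A" "g \<in> H"
      using x subspace by (auto simp: g A_def H_def evaluation_def dual_space_sel(3,4))
    ultimately show "g \<in> A \<inter> (H \<inter> ?box)" by blast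
  next
    fix g assume g: "g \<in> A \<inter> (H \<inter> ?box)"
    have g_le: "norm (g f) \<le> M * nrm ?E' f" if "f \<in> P" for f
      using g that by (auto simp: PiE_iff)
    have "g \<in> extensional P" using g by (auto simp: PiE_iff)
    moreover have "g (add ?E' f h) = g f + g h" if "f \<in> P" "h \<in> P" for f h
      using g that by (auto simp: A_def)
    moreover have "g (smul ?E' c f) = c * g f" if "f \<in> P" for c f
      using g that by (auto simp: H_def)
    moreover have "\<exists>C. \<forall>f\<in>P. norm (g f) \<le> C * nrm ?E' f" using g_le by blast
    ultimately have g': "g \<in> car ?P'" by (simp add: dual_space_sel(1))
    then obtain x where x: "x \<in> car E" "g = evaluation P x"
      using dual unfolding is_dual_of_def Let_def bij_betw_def by blast
    have "nrm E x = nrm ?P' g" using dual x unfolding is_dual_of_def Let_def by simp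
    also have "\<dots> \<le> M"
      unfolding dual_space_sel(5)[of "?E'\<lparr>car := P\<rparr>"]
    proof (rule cSup_least)
      \<comment> \<open>The zero functional has norm at most \<open>1\<close>, so the set is nonempty and its supremum is not an
          arbitrary value.\<close>
      have "nrm ?E' (zer ?E') = Sup {0}"
        unfolding dual_space_sel
        by (rule arg_cong[of _ _ Sup]) (use zer_closed nrm_eq_0[OF zer_closed] in \<open>auto intro!: exI[of _ "zer E"]\<close>)
      then show "{norm (g f) |f. f \<in> car (?E'\<lparr>car := P\<rparr>) \<and> nrm (?E'\<lparr>car := P\<rparr>) f \<le> 1} \<noteq> {}"
        using subspace(2) by auto
    next
      fix r assume "r \<in> {norm (g f) |f. f \<in> car (?E'\<lparr>car := P\<rparr>) \<and> nrm (?E'\<lparr>car := P\<rparr>) f \<le> 1}"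
      then obtain f where f: "f \<in> P" "nrm ?E' f \<le> 1" "r = norm (g f)" by auto
      have "M * nrm ?E' f \<le> M * 1" using f M by (intro mult_left_mono) auto
      then show "r \<le> M" using g_le[OF f(1)] f by simp
    qed
    finally show "g \<in> evaluation P ` ?B" using x by blast
  qed
  ultimately show ?thesis
    unfolding wstar_def by (intro compactin_pullback_topology) auto
qed

section \<open>Invariance of dual modules under isometric isomorphism\<close>

text \<open>
  The carrier of \<open>E\<close> is required to be closed under the operations, so that the notion also makes
  sense for records not known to be Banach spaces, such as a subspace of a dual space.
\<close>

definition isometric_iso ::
    "('v \<Rightarrow> 'w) \<Rightarrow> ('k::{real_normed_field, heine_borel}, 'v, 'y) nspace_scheme \<Rightarrow>
     ('k, 'w, 'z) nspace_scheme \<Rightarrow> bool" where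
  "isometric_iso T E E' \<longleftrightarrow>
     bij_betw T (car E) (car E') \<and>
     zer E \<in> car E \<and> T (zer E) = zer E' \<and>
     (\<forall>x\<in>car E. \<forall>y\<in>car E. add E x y \<in> car E \<and> T (add E x y) = add E' (T x) (T y)) \<and>
     (\<forall>c. \<forall>x\<in>car E. smul E c x \<in> car E \<and> T (smul E c x) = smul E' c (T x)) \<and>
     (\<forall>x\<in>car E. nrm E' (T x) = nrm E x)"

lemma isometric_isoD:
  assumes "isometric_iso T E E'"
  shows "inj_on T (car E)" "car E' = T ` car E" "zer E' = T (zer E)" "zer E \<in> car E"
    and "\<lbrakk>x \<in> car E; y \<in> car E\<rbrakk> \<Longrightarrow> add E x y \<in> car E"
    and "\<lbrakk>x \<in> car E; y \<in> car E\<rbrakk> \<Longrightarrow> add E' (T x) (T y) = T (add E x y)"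
    and "x \<in> car E \<Longrightarrow> smul E c x \<in> car E"
    and "x \<in> car E \<Longrightarrow> smul E' c (T x) = T (smul E c x)"
    and "x \<in> car E \<Longrightarrow> nrm E' (T x) = nrm E x"
    and "\<lbrakk>x \<in> car E; y \<in> car E\<rbrakk> \<Longrightarrow> sub E x y \<in> car E"
    and "\<lbrakk>x \<in> car E; y \<in> car E\<rbrakk> \<Longrightarrow> sub E' (T x) (T y) = T (sub E x y)"
  using assms by (auto simp: isometric_iso_def bij_betw_def sub_def)

lemma isometric_iso_inv:
  assumes "isometric_iso T E E'"
  shows "isometric_iso (inv_into (car E) T) E' E"
  using assms bij_betw_inv_into[of T "car E" "car E'"]
  unfolding isometric_iso_def
  by (auto simp: isometric_isoD[OF assms])

text \<open>
  The result is cut off to \<open>undefined\<close> outside the carrier, as required of the members of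
  \<open>dual_space E\<close>.
\<close>

definition adjoint :: "('v \<Rightarrow> 'w) \<Rightarrow> ('k::{real_normed_field, heine_borel}, 'v, 'y) nspace_scheme \<Rightarrow>
    ('w \<Rightarrow> 'k) \<Rightarrow> 'v \<Rightarrow> 'k" where
  "adjoint T E f = (\<lambda>x\<in>car E. f (T x))"

lemma adjoint_in_dual_space:
  assumes "isometric_iso T E E'" and "f \<in> car (dual_space E')"
  shows "adjoint T E f \<in> car (dual_space E)"
  using assms(2) by (simp add: adjoint_def dual_space_sel isometric_isoD[OF assms(1)])

lemma adjoint_adjoint_inv:
  assumes "isometric_iso T E E'" and "f \<in> car (dual_space E')"
  shows "adjoint (inv_into (car E) T) E' (adjoint T E f) = f"
  using assms(2) isometric_isoD(1)[OF assms(1)]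
  by (auto simp: adjoint_def dual_space_sel(1) isometric_isoD(2)[OF assms(1)]
      extensional_def fun_eq_iff restrict_def)

lemma adjoint_inv_adjoint:
  assumes "isometric_iso T E E'" and "f \<in> car (dual_space E)"
  shows "adjoint T E (adjoint (inv_into (car E) T) E' f) = f"
  using assms(2) isometric_isoD(1)[OF assms(1)]
  by (auto simp: adjoint_def dual_space_sel(1) isometric_isoD(2)[OF assms(1)]
      extensional_def fun_eq_iff restrict_def)

text \<open>
  The sum of two bounded functionals and the scalar multiples of one are bounded functionals as soon
  as the carrier of \<open>E\<close> is closed under the operations, which is part of \<open>isometric_iso\<close>.
\<close>

lemma dual_space_closed:
  fixes E :: "('k::{real_normed_field, heine_borel}, 'v, 'y) nspace_scheme"
  assumes "isometric_iso T E E'"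
  shows "zer (dual_space E) \<in> car (dual_space E)"
    and "\<lbrakk>f \<in> car (dual_space E); g \<in> car (dual_space E)\<rbrakk> \<Longrightarrow> add (dual_space E) f g \<in> car (dual_space E)"
    and "f \<in> car (dual_space E) \<Longrightarrow> smul (dual_space E) c f \<in> car (dual_space E)"
proof -
  note closed = isometric_isoD(4,5,7)[OF assms]
  show "zer (dual_space E) \<in> car (dual_space E)"
    using closed by (auto simp: dual_space_sel intro: exI[of _ 0])
  show "add (dual_space E) f g \<in> car (dual_space E)"
    if fg: "f \<in> car (dual_space E)" "g \<in> car (dual_space E)"
  proof -
    obtain C D where "\<forall>x\<in>car E. norm (f x) \<le> C * nrm E x" "\<forall>x\<in>car E. norm (g x) \<le> D * nrm E x"
      using fg by (auto simp: dual_space_sel)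
    then have "\<exists>K. \<forall>x\<in>car E. norm (f x + g x) \<le> K * nrm E x"
      by (intro exI[of _ "C + D"]) (auto simp: distrib_right intro!: norm_triangle_le add_mono)
    then show ?thesis using fg closed by (simp add: dual_space_sel add_ac distrib_left)
  qed
  show "smul (dual_space E) c f \<in> car (dual_space E)" if f: "f \<in> car (dual_space E)"
  proof -
    obtain C where "\<forall>x\<in>car E. norm (f x) \<le> C * nrm E x"
      using f by (auto simp: dual_space_sel)
    then have "\<exists>K. \<forall>x\<in>car E. norm (c * f x) \<le> K * nrm E x"
      by (intro exI[of _ "norm c * C"]) (auto simp: norm_mult mult.assoc intro!: mult_left_mono)
    then show ?thesis using f closed by (simp add: dual_space_sel distrib_left mult.left_commute)
  qed
qed

text \<open>
  Dualizing is functorial on isometric isomorphisms. Applied twice, this carries the duality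
  \<open>E = P\<^sup>*\<close> over to an isometric copy of \<open>E\<close>.
\<close>

lemma isometric_iso_adjoint:
  assumes T: "isometric_iso T E E'"
  shows "isometric_iso (adjoint T E) (dual_space E') (dual_space E)"
proof -
  note [simp] = isometric_isoD[OF T]
  have inv: "isometric_iso (inv_into (car E) T) E' E" by (rule isometric_iso_inv[OF T])
  have "bij_betw (adjoint T E) (car (dual_space E')) (car (dual_space E))"
    by (rule bij_betw_byWitness[where f' = "adjoint (inv_into (car E) T) E'"])
       (use adjoint_adjoint_inv[OF T] adjoint_inv_adjoint[OF T] adjoint_in_dual_space[OF T]
          adjoint_in_dual_space[OF inv] in blast)+
  moreover have "nrm (dual_space E) (adjoint T E f) = nrm (dual_space E') f" for f
    unfolding dual_space_sel by (rule arg_cong[of _ _ Sup]) (force simp: adjoint_def)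
  ultimately show ?thesis
    unfolding isometric_iso_def
    using dual_space_closed[OF inv]
    by (auto simp: adjoint_def dual_space_sel(2-4))
qed

lemma closed_subspaceD:
  assumes "closed_subspace E P"
  shows "P \<subseteq> car E" "zer E \<in> P"
    and "\<lbrakk>x \<in> P; y \<in> P\<rbrakk> \<Longrightarrow> add E x y \<in> P" "x \<in> P \<Longrightarrow> smul E c x \<in> P"
    and "\<lbrakk>\<And>n. s n \<in> P; l \<in> car E; (\<lambda>n. nrm E (sub E (s n) l)) \<longlonglongrightarrow> 0\<rbrakk> \<Longrightarrow> l \<in> P"
  using assms unfolding closed_subspace_def by blast+

lemma isometric_iso_subspace:
  assumes T: "isometric_iso T E E'" and "closed_subspace E P"
  shows "isometric_iso T (E\<lparr>car := P\<rparr>) (E'\<lparr>car := T ` P\<rparr>)"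
proof -
  have "inj_on T P"
    using isometric_isoD(1)[OF T] closed_subspaceD(1)[OF assms(2)] inj_on_subset by blast
  then show ?thesis
    using T closed_subspaceD(1-4)[OF assms(2)]
    by (auto simp: isometric_iso_def bij_betw_def subset_iff)
qed

lemma closed_subspace_image:
  assumes T: "isometric_iso T E E'" and P: "closed_subspace E P"
  shows "closed_subspace E' (T ` P)"
proof -
  note [simp] = isometric_isoD(2-11)[OF T]
  note P = closed_subspaceD[OF P]
  have sub: "x \<in> car E" if "x \<in> P" for x using P(1) that by blast
  have "l \<in> T ` P"
    if s: "\<And>n. s n \<in> T ` P" and l: "l \<in> car E'" and lim: "(\<lambda>n. nrm E' (sub E' (s n) l)) \<longlonglongrightarrow> 0"
    for s :: "nat \<Rightarrow> _" and l
  proof -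
    have "\<forall>n. \<exists>x. x \<in> P \<and> s n = T x" using s by blast
    then obtain t where t: "\<And>n. t n \<in> P \<and> s n = T (t n)" by metis
    obtain m where m: "m \<in> car E" "l = T m" using l by auto
    have "nrm E' (sub E' (s n) l) = nrm E (sub E (t n) m)" for n
      using t m sub by simp
    then have "(\<lambda>n. nrm E (sub E (t n) m)) \<longlonglongrightarrow> 0" using lim by simp
    then have "m \<in> P" using P(5)[of t m] t m by blast
    then show ?thesis using m by blast
  qed
  then show ?thesis
    unfolding closed_subspace_def
  proof (intro conjI ballI allI impI)
    show "T ` P \<subseteq> car E'" using P(1) by auto
    show "zer E' \<in> T ` P" using P(2) by simp
    show "add E' x y \<in> T ` P" if "x \<in> T ` P" "y \<in> T ` P" for x y
      using that P(3) sub by auto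
    show "smul E' c x \<in> T ` P" if "x \<in> T ` P" for c x
      using that P(4) sub by auto
  qed blast
qed

text \<open>
  Write \<open>Q\<close> for the transported predual, \<open>S\<close> for the inverse of \<open>T\<close>, and \<open>\<Psi>\<close> for the inverse of the
  transport \<open>P \<rightarrow> Q\<close> of functionals. Evaluation is natural: the evaluation of \<open>E'\<close> on \<open>Q\<close> is the
  composition of \<open>S\<close>, the evaluation of \<open>E\<close> on \<open>P\<close>, and the adjoint of \<open>\<Psi>\<close>. All three are
  isometric bijections.
\<close>

lemma is_dual_of_image:
  assumes T: "isometric_iso T E E'" and P: "closed_subspace (dual_space E) P" and dual: "is_dual_of E P"
  shows "is_dual_of E' (adjoint (inv_into (car E) T) E' ` P)"
proof -
  define S where "S = inv_into (car E) T"
  define \<Phi> where "\<Phi> = adjoint S E'"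
  define \<Psi> where "\<Psi> = inv_into P \<Phi>"
  let ?P' = "dual_space ((dual_space E)\<lparr>car := P\<rparr>)"
  let ?Q = "(dual_space E')\<lparr>car := \<Phi> ` P\<rparr>"
  have S: "isometric_iso S E' E" unfolding S_def by (rule isometric_iso_inv[OF T])
  have \<Phi>: "isometric_iso \<Phi> ((dual_space E)\<lparr>car := P\<rparr>) ?Q"
    unfolding \<Phi>_def by (rule isometric_iso_subspace[OF isometric_iso_adjoint[OF S] P])
  have "isometric_iso \<Psi> ?Q ((dual_space E)\<lparr>car := P\<rparr>)"
    using isometric_iso_inv[OF \<Phi>] by (simp add: \<Psi>_def)
  then have iso: "isometric_iso (adjoint \<Psi> ?Q) ?P' (dual_space ?Q)"
    by (rule isometric_iso_adjoint)
  have inj: "inj_on \<Phi> P" using isometric_isoD(1)[OF \<Phi>] by simp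
  have eval: "evaluation (\<Phi> ` P) x = adjoint \<Psi> ?Q (evaluation P (S x))" if "x \<in> car E'" for x
  proof
    fix g
    show "evaluation (\<Phi> ` P) x g = adjoint \<Psi> ?Q (evaluation P (S x)) g"
    proof (cases "g \<in> \<Phi> ` P")
      case True
      then obtain f where f: "f \<in> P" "g = \<Phi> f" by blast
      then have "\<Psi> g = f" using inj by (simp add: \<Psi>_def)
      moreover have "g x = f (S x)" using that f by (simp add: \<Phi>_def adjoint_def)
      ultimately show ?thesis using f True by (simp add: evaluation_def adjoint_def)
    qed (simp add: evaluation_def adjoint_def)
  qed
  have "bij_betw (evaluation P \<circ> S) (car E') (car ?P')"
    using dual S unfolding is_dual_of_def Let_def isometric_iso_def by (blast intro: bij_betw_trans)
  then have "bij_betw (adjoint \<Psi> ?Q \<circ> (evaluation P \<circ> S)) (car E') (car (dual_space ?Q))"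
    using iso unfolding isometric_iso_def by (blast intro: bij_betw_trans)
  then have bij: "bij_betw (evaluation (\<Phi> ` P)) (car E') (car (dual_space ?Q))"
    by (rule bij_betw_cong[THEN iffD1, rotated]) (simp add: eval)
  have "nrm (dual_space ?Q) (evaluation (\<Phi> ` P) x) = nrm E' x" if "x \<in> car E'" for x
  proof -
    have "S x \<in> car E" "nrm E (S x) = nrm E' x"
      using S that by (auto simp: isometric_iso_def bij_betw_def)
    moreover from this have "evaluation P (S x) \<in> car ?P'" "nrm ?P' (evaluation P (S x)) = nrm E (S x)"
      using dual unfolding is_dual_of_def Let_def bij_betw_def by auto
    ultimately show ?thesis using that by (simp add: eval isometric_isoD(9)[OF iso])
  qed
  then show ?thesis
    using bij unfolding is_dual_of_def Let_def \<Phi>_def S_def by blast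
qed

lemma banach_space_image:
  fixes E :: "('k::{real_normed_field, heine_borel}, 'v, 'y) nspace_scheme"
    and E' :: "('k, 'w, 'z) nspace_scheme"
  assumes T: "isometric_iso T E E'" and "banach_space E"
  shows "banach_space E'"
proof -
  interpret banach_space E by fact
  note [simp] = isometric_isoD(2-11)[OF T] inj_on_eq_iff[OF isometric_isoD(1)[OF T]]
  show ?thesis
  proof
    fix s :: "nat \<Rightarrow> 'w"
    assume s: "\<And>n. s n \<in> car E'"
      and Cauchy: "\<And>e. e > 0 \<Longrightarrow> \<exists>N. \<forall>m\<ge>N. \<forall>n\<ge>N. nrm E' (sub E' (s m) (s n)) < e"
    have "\<forall>n. \<exists>x. x \<in> car E \<and> s n = T x" using s by auto
    then obtain t where t: "\<And>n. t n \<in> car E \<and> s n = T (t n)" by metis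
    have "\<exists>l\<in>car E. (\<lambda>n. nrm E (sub E (t n) l)) \<longlonglongrightarrow> 0"
      using Cauchy t by (intro complete) auto
    then show "\<exists>l\<in>car E'. (\<lambda>n. nrm E' (sub E' (s n) l)) \<longlonglongrightarrow> 0"
      using t by auto
  next
    fix x y z :: 'w and c d :: 'k
    assume "x \<in> car E'"
    then obtain u where x: "x = T u" "u \<in> car E" by auto
    show "smul E' c x \<in> car E'" using x by simp
    show "add E' (zer E') x = x" using x by (simp add: add_zer)
    show "sub E' x x = zer E'" using x by (simp add: add_neg)
    show "smul E' (c + d) x = add E' (smul E' c x) (smul E' d x)" using x by (simp add: smul_add_left)
    show "smul E' c (smul E' d x) = smul E' (c * d) x" using x by (simp add: smul_smul)
    show "smul E' 1 x = x" using x by (simp add: smul_one)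
    show "0 \<le> nrm E' x" using x by (simp add: nrm_nonneg)
    show "nrm E' x = 0 \<longleftrightarrow> x = zer E'" using x by (simp add: nrm_eq_0)
    show "nrm E' (smul E' c x) = norm c * nrm E' x" using x by (simp add: nrm_smul)
    assume "y \<in> car E'"
    then obtain v where y: "y = T v" "v \<in> car E" by auto
    show "add E' x y \<in> car E'" using x y by simp
    show "add E' x y = add E' y x" using x y by (simp add: add_commute)
    show "smul E' c (add E' x y) = add E' (smul E' c x) (smul E' c y)"
      using x y by (simp add: smul_add_right)
    show "nrm E' (add E' x y) \<le> nrm E' x + nrm E' y" using x y by (simp add: nrm_triangle)
    assume "z \<in> car E'"
    then obtain w where z: "z = T w" "w \<in> car E" by auto
    show "add E' (add E' x y) z = add E' x (add E' y z)" using x y z by (simp add: add_assoc)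
  qed (simp add: zer_closed)
qed

definition bimodule_iso ::
    "('v \<Rightarrow> 'w) \<Rightarrow> ('k::{real_normed_field, heine_borel}, 'a, 'v) bimodule \<Rightarrow> ('k, 'a, 'w) bimodule \<Rightarrow> bool" where
  "bimodule_iso T E E' \<longleftrightarrow> isometric_iso T E E' \<and>
     (\<forall>a. \<forall>x\<in>car E. T (lact E a x) = lact E' a (T x) \<and> T (ract E x a) = ract E' (T x) a)"

lemma bimodule_isoD:
  assumes "bimodule_iso T E E'"
  shows "isometric_iso T E E'"
    and "x \<in> car E \<Longrightarrow> lact E' a (T x) = T (lact E a x)"
    and "x \<in> car E \<Longrightarrow> ract E' (T x) a = T (ract E x a)"
  using assms by (auto simp: bimodule_iso_def)

lemma banach_bimodule_image:
  fixes E :: "('k::{real_normed_field, heine_borel}, 'a::{real_normed_algebra, banach}, 'v) bimodule"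
    and E' :: "('k, 'a, 'w) bimodule"
  assumes T: "bimodule_iso T E E'" and "banach_bimodule smA E"
  shows "banach_bimodule smA E'"
proof -
  interpret banach_bimodule smA E by fact
  note iso = bimodule_isoD(1)[OF T]
  note [simp] = isometric_isoD(2-11)[OF iso] bimodule_isoD(2,3)[OF T] lact_closed ract_closed
  interpret E': banach_space E'
    by (rule banach_space_image[OF iso]) unfold_locales
  show ?thesis
  proof
    fix x y :: 'w and a b :: 'a and c :: 'k
    assume "x \<in> car E'"
    then obtain u where x: "x = T u" "u \<in> car E" by auto
    show "lact E' a x \<in> car E'" "ract E' x a \<in> car E'" using x by simp_all
    show "lact E' a (smul E' c x) = smul E' c (lact E' a x)"
      "ract E' (smul E' c x) a = smul E' c (ract E' x a)"
      using x by (simp_all add: lact_smul ract_smul)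
    show "lact E' (a + b) x = add E' (lact E' a x) (lact E' b x)"
      "ract E' x (a + b) = add E' (ract E' x a) (ract E' x b)"
      using x by (simp_all add: add_lact add_ract)
    show "lact E' (smA c a) x = smul E' c (lact E' a x)" "ract E' x (smA c a) = smul E' c (ract E' x a)"
      using x by (simp_all add: scale_lact scale_ract)
    show "lact E' (a * b) x = lact E' a (lact E' b x)" "ract E' x (a * b) = ract E' (ract E' x a) b"
      "ract E' (lact E' a x) b = lact E' a (ract E' x b)"
      using x by (simp_all add: lact_mult ract_mult lact_ract)
    assume "y \<in> car E'"
    then obtain v where y: "y = T v" "v \<in> car E" by auto
    show "lact E' a (add E' x y) = add E' (lact E' a x) (lact E' a y)"
      "ract E' (add E' x y) a = add E' (ract E' x a) (ract E' y a)"
      using x y by (simp_all add: lact_add ract_add)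
  next
    show "\<exists>C. \<forall>a. \<forall>x\<in>car E'. nrm E' (lact E' a x) \<le> C * norm a * nrm E' x \<and>
                             nrm E' (ract E' x a) \<le> C * norm a * nrm E' x"
      using bounded by simp
  qed
qed

lemma dual_banach_bimodule_image:
  assumes T: "bimodule_iso T E E'" and "dual_banach_bimodule smA E P"
  shows "dual_banach_bimodule smA E' (adjoint (inv_into (car E) T) E' ` P)"
proof -
  interpret dual_banach_bimodule smA E P by fact
  let ?\<Phi> = "adjoint (inv_into (car E) T) E'"
  note iso = bimodule_isoD(1)[OF T]
  note [simp] = isometric_isoD(2)[OF iso] inv_into_f_f[OF isometric_isoD(1)[OF iso]]
    inj_on_eq_iff[OF isometric_isoD(1)[OF iso]]
    bimodule_isoD(2,3)[OF T] lact_closed ract_closed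
  interpret E': banach_bimodule smA E'
    by (rule banach_bimodule_image[OF T]) unfold_locales
  have acts: "dual_lact E' a (?\<Phi> f) = ?\<Phi> (dual_lact E a f)"
    "dual_ract E' (?\<Phi> f) a = ?\<Phi> (dual_ract E f a)" for a f
    by (auto simp: dual_lact_def dual_ract_def adjoint_def fun_eq_iff restrict_def)
  show ?thesis
  proof unfold_locales
    show "closed_subspace (dual_space E') (?\<Phi> ` P)"
      by (rule closed_subspace_image[OF isometric_iso_adjoint[OF isometric_iso_inv[OF iso]] predual_closed_subspace])
    show "is_dual_of E' (?\<Phi> ` P)"
      by (rule is_dual_of_image[OF iso predual_closed_subspace is_dual])
  qed (auto simp: acts predual_lact predual_ract)
qed

lemma wstar_continuous_image:
  assumes T: "isometric_iso T E E'" and "wstar_continuous smA Apre E P D"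
  shows "wstar_continuous smA Apre E' (adjoint (inv_into (car E) T) E' ` P) (\<lambda>a. T (D a))"
  unfolding wstar_continuous_def continuous_map_into_wstar_iff
proof (intro conjI ballI)
  let ?A = "self_bimodule smA"
  have car: "D ` topspace (wstar ?A Apre) \<subseteq> car E"
    and cont: "\<And>f. f \<in> P \<Longrightarrow> continuous_map (wstar ?A Apre) euclidean (\<lambda>a. f (D a))"
    using assms(2) unfolding wstar_continuous_def continuous_map_into_wstar_iff by blast+
  show "(\<lambda>a. T (D a)) ` topspace (wstar ?A Apre) \<subseteq> car E'"
    using car isometric_isoD(2)[OF T] by blast
  fix g assume "g \<in> adjoint (inv_into (car E) T) E' ` P"
  then obtain f where "f \<in> P" and g: "g = adjoint (inv_into (car E) T) E' f" by blast
  have "g (T (D a)) = f (D a)" for a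
  proof -
    have "D a \<in> car E" using car by (auto simp: self_bimodule_def)
    then show ?thesis
      using isometric_isoD(1,2)[OF T] by (simp add: g adjoint_def)
  qed
  then show "continuous_map (wstar ?A Apre) euclidean (\<lambda>a. g (T (D a)))"
    using cont[OF \<open>f \<in> P\<close>] by simp
qed

lemma normal_dual_banach_bimodule_image:
  assumes T: "bimodule_iso T E E'" and E: "normal_dual_banach_bimodule smA Apre E P"
  shows "normal_dual_banach_bimodule smA Apre E' (adjoint (inv_into (car E) T) E' ` P)"
  unfolding normal_dual_banach_bimodule_def
proof (intro conjI ballI)
  let ?Q = "adjoint (inv_into (car E) T) E' ` P"
  have dual: "dual_banach_bimodule smA E P"
    and cont: "\<And>x. x \<in> car E \<Longrightarrow> wstar_continuous smA Apre E P (\<lambda>a. lact E a x)"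
      "\<And>x. x \<in> car E \<Longrightarrow> wstar_continuous smA Apre E P (\<lambda>a. ract E x a)"
    using E by (simp_all add: normal_dual_banach_bimodule_def)
  note iso = bimodule_isoD(1)[OF T]
  show "dual_banach_bimodule smA E' ?Q" by (rule dual_banach_bimodule_image[OF T dual])
  fix y assume "y \<in> car E'"
  then obtain x where x: "x \<in> car E" "y = T x" using isometric_isoD(2)[OF iso] by blast
  show "wstar_continuous smA Apre E' ?Q (\<lambda>a. lact E' a y)"
    using wstar_continuous_image[OF iso cont(1)] x by (simp add: bimodule_isoD(2)[OF T])
  show "wstar_continuous smA Apre E' ?Q (\<lambda>a. ract E' y a)"
    using wstar_continuous_image[OF iso cont(2)] x by (simp add: bimodule_isoD(3)[OF T])
qed

definition transport :: "('v \<Rightarrow> 'w) \<Rightarrow> ('k, 'a, 'v) bimodule \<Rightarrow> ('k, 'a, 'w) bimodule" where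
  "transport T E = (let S = inv_into (car E) T in
     \<lparr>car = T ` car E, zer = T (zer E), add = (\<lambda>x y. T (add E (S x) (S y))),
      smul = (\<lambda>c x. T (smul E c (S x))), nrm = (\<lambda>x. nrm E (S x)),
      lact = (\<lambda>a x. T (lact E a (S x))), ract = (\<lambda>x a. T (ract E (S x) a))\<rparr>)"

lemma bimodule_iso_transport:
  assumes "banach_space E" and "inj_on T (car E)"
  shows "bimodule_iso T E (transport T E)"
proof -
  interpret banach_space E by fact
  show ?thesis
    using assms(2)
    by (auto simp: bimodule_iso_def isometric_iso_def transport_def Let_def bij_betw_def
        zer_closed add_closed smul_closed)
qed

text \<open>
  Pointwise Connes amenability is defined through modules with carrier in a single type. Everything
  in sight is invariant under isomorphism, so it applies to every module whose carrier embeds into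
  that type.
\<close>

lemma pointwise_Connes_amenable_atD:
  fixes E :: "('k::{real_normed_field, heine_borel}, 'a::{real_normed_algebra, banach}, 'v) bimodule"
    and T :: "'v \<Rightarrow> 'a set set"
  assumes "pointwise_Connes_amenable_at smA Apre a0"
    and E: "normal_dual_banach_bimodule smA Apre E P"
    and D: "derivation smA E D" and D': "wstar_continuous smA Apre E P D"
    and inj: "inj_on T (car E)"
  shows "\<exists>x\<in>car E. D a0 = sub E (lact E a0 x) (ract E x a0)"
proof -
  interpret dual_banach_bimodule smA E P
    using E by (simp add: normal_dual_banach_bimodule_def)
  let ?E' = "transport T E"
  have T: "bimodule_iso T E ?E'"
    by (rule bimodule_iso_transport[OF _ inj]) unfold_locales
  note iso = bimodule_isoD(1)[OF T]
  note [simp] = isometric_isoD(2-11)[OF iso] bimodule_isoD(2,3)[OF T] lact_closed ract_closed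
  have D_car: "D a \<in> car E" for a using D by (simp add: derivation_def)
  have "derivation smA ?E' (\<lambda>a. T (D a))"
    using D D_car by (simp add: derivation_def)
  then have "\<exists>y\<in>car ?E'. T (D a0) = sub ?E' (lact ?E' a0 y) (ract ?E' y a0)"
    using assms(1)[unfolded pointwise_Connes_amenable_at_def, rule_format]
      normal_dual_banach_bimodule_image[OF T E] wstar_continuous_image[OF iso D'] by blast
  then obtain y where "y \<in> car ?E'" "T (D a0) = sub ?E' (lact ?E' a0 y) (ract ?E' y a0)" by blast
  then obtain x where x: "x \<in> car E" "T (D a0) = T (sub E (lact E a0 x) (ract E x a0))" by auto
  then have "D a0 = sub E (lact E a0 x) (ract E x a0)"
    using inj D_car by (simp add: inj_on_eq_iff)
  then show ?thesis using x by blast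
qed

section \<open>From local units to an identity element\<close>

text \<open>
  With zero right action, a derivation is the same as a bounded left module map, so that the
  identity map becomes a derivation.
\<close>

definition left_module :: "('k \<Rightarrow> 'a \<Rightarrow> 'a) \<Rightarrow> ('k, 'a::real_normed_algebra, 'a) bimodule" where
  "left_module smA = (self_bimodule smA)\<lparr>ract := \<lambda>x a. 0\<rparr>"

lemma self_bimodule_sel [simp]:
  "car (self_bimodule smA) = UNIV" "zer (self_bimodule smA) = 0" "add (self_bimodule smA) = (+)"
  "smul (self_bimodule smA) = smA" "nrm (self_bimodule smA) = norm"
  "lact (self_bimodule smA) = (*)" "ract (self_bimodule smA) = (*)"
  by (simp_all add: self_bimodule_def)

lemma left_module_sel [simp]:
  "car (left_module smA) = UNIV" "zer (left_module smA) = 0" "add (left_module smA) = (+)"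
  "smul (left_module smA) = smA" "nrm (left_module smA) = norm"
  "lact (left_module smA) = (*)" "ract (left_module smA) = (\<lambda>x a. 0)"
  by (simp_all add: left_module_def self_bimodule_def)

lemma dual_space_left_module: "dual_space (left_module smA) = dual_space (self_bimodule smA)"
  by (simp add: dual_space_def)

text \<open>
  The left action is the multiplication of the algebra, which is separately weak-star continuous
  because the predual is a submodule; the right action is zero, and so is the induced left action on
  the predual.
\<close>

lemma normal_left_module:
  assumes "dual_banach_algebra smA Apre"
  shows "normal_dual_banach_bimodule smA Apre (left_module smA) Apre"
proof -
  interpret self: dual_banach_bimodule smA "self_bimodule smA" Apre
    using assms by (simp add: dual_banach_algebra_def)
  have "banach_space (self_bimodule smA)" by unfold_locales
  then interpret L: banach_space "left_module smA"
    by (simp add: banach_space_def sub_def)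
  note Apre = closed_subspaceD[OF self.predual_closed_subspace]
  have f: "f \<in> car (dual_space (self_bimodule smA))" if "f \<in> Apre" for f
    using Apre(1) that by blast
  \<comment> \<open>The second conjunct is the bound for the right action, which is zero.\<close>
  have bounded: "\<exists>C. \<forall>a x. norm (a * x) \<le> C * norm a * norm (x :: 'b) \<and> 0 \<le> C * norm a * norm x"
    by (rule exI[of _ 1]) (simp add: norm_mult_ineq)
  have "dual_banach_bimodule smA (left_module smA) Apre"
  proof unfold_locales
    show "closed_subspace (dual_space (left_module smA)) Apre"
      using self.predual_closed_subspace by (simp add: dual_space_left_module)
    show "is_dual_of (left_module smA) Apre"
      using self.is_dual by (simp add: is_dual_of_def dual_space_left_module)
  next
    fix f a assume "f \<in> Apre"
    have "f 0 = 0"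
    proof -
      have "f (0 + 0) = f 0 + f 0"
        using f[OF \<open>f \<in> Apre\<close>] unfolding dual_space_sel self_bimodule_sel by blast
      then show ?thesis by simp
    qed
    then show "dual_lact (left_module smA) a f \<in> Apre"
      using Apre(2) by (simp add: dual_lact_def dual_space_sel)
    show "dual_ract (left_module smA) f a \<in> Apre"
      using self.predual_ract[OF \<open>f \<in> Apre\<close>] by (simp add: dual_ract_def)
  qed (use bounded in \<open>auto simp: algebra_simps self.A.scale_right_distrib self.A.scale_mult_left self.A.scale_mult_right\<close>)
  moreover have "wstar_continuous smA Apre (left_module smA) Apre (\<lambda>a. a * x)" for x
  proof -
    have "continuous_map (wstar (self_bimodule smA) Apre) euclidean (\<lambda>a. f (a * x))" if "f \<in> Apre" for f
      using continuous_map_wstar_functional[OF self.predual_lact[OF that, of x]]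
      by (simp add: dual_lact_def)
    then show ?thesis by (simp add: wstar_continuous_def continuous_map_into_wstar_iff)
  qed
  moreover have "wstar_continuous smA Apre (left_module smA) Apre (\<lambda>a. 0)"
    by (simp add: wstar_continuous_def continuous_map_into_wstar_iff)
  ultimately show ?thesis by (simp add: normal_dual_banach_bimodule_def)
qed

text \<open>
  An element \<open>x\<close> of \<open>left_module smA\<close> that implements the identity derivation at \<open>a\<close> satisfies
  \<open>a = a x - x \<cdot> a = a x\<close>.
\<close>

lemma pointwise_Connes_amenable_at_imp_unit:
  assumes dual: "dual_banach_algebra smA Apre"
    and am: "pointwise_Connes_amenable_at smA Apre a"
  shows "\<exists>e. a * e = a"
proof -
  interpret self: dual_banach_bimodule smA "self_bimodule smA" Apre
    using dual by (simp add: dual_banach_algebra_def)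
  have "derivation smA (left_module smA) (\<lambda>a. a)"
    unfolding derivation_def by (auto intro!: exI[of _ 1])
  moreover have "wstar_continuous smA Apre (left_module smA) Apre (\<lambda>a. a)"
    by (simp add: wstar_continuous_def continuous_map_into_wstar_iff continuous_map_wstar_functional)
  \<comment> \<open>Singletons of singletons embed the algebra into the type over which the modules range.\<close>
  moreover have "inj_on (\<lambda>a. {{a}}) (car (left_module smA))" by (simp add: inj_on_def)
  ultimately have "\<exists>x\<in>car (left_module smA).
      a = sub (left_module smA) (lact (left_module smA) a x) (ract (left_module smA) x a)"
    by (rule pointwise_Connes_amenable_atD[OF am normal_left_module[OF dual]])
  then show ?thesis by (auto simp: sub_def intro: sym)
qed

text \<open>
  The conditions \<open>\<bar>f (a u - a)\<bar> \<le> \<epsilon>\<close>, for \<open>a\<close> in the algebra, \<open>f\<close> in the predual and \<open>\<epsilon> > 0\<close>, define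
  weak-star closed sets of \<open>u\<close>, since \<open>u \<mapsto> f (a u)\<close> is again in the predual. Finitely many of them
  are met by an approximate joint unit in the ball of radius \<open>r\<close>. By compactness some \<open>e\<close> satisfies
  all of them, and \<open>a e = a\<close> because the predual separates the points.
\<close>

lemma identity_from_bounded_approximate_joint_units:
  fixes smA :: "'k::{real_normed_field, heine_borel} \<Rightarrow> 'a::{real_normed_algebra, banach} \<Rightarrow> 'a"
  assumes dual: "dual_banach_algebra smA Apre" and "0 < r"
    and approx: "\<And>S \<delta>. \<lbrakk>finite (S :: 'a set); \<delta> > 0\<rbrakk> \<Longrightarrow> \<exists>u. norm u \<le> r \<and> (\<forall>a\<in>S. norm (a * u - a) < \<delta>)"
  shows "\<exists>e :: 'a. \<forall>a. a * e = a"
proof -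
  let ?A = "self_bimodule smA"
  let ?W = "wstar ?A Apre"
  let ?B = "{x. norm x \<le> r} :: 'a set"
  interpret self: dual_banach_bimodule smA ?A Apre
    using dual by (simp add: dual_banach_algebra_def)
  have functional: "f (x - y) = f x - f y" "\<exists>C. \<forall>x. norm (f x) \<le> C * norm x" if "f \<in> Apre" for f x y
  proof -
    have f: "f \<in> car (dual_space ?A)"
      using closed_subspaceD(1)[OF self.predual_closed_subspace] that by blast
    then have "f (x - y + y) = f (x - y) + f y"
      unfolding dual_space_sel self_bimodule_sel by blast
    then show "f (x - y) = f x - f y" by (simp add: algebra_simps)
    show "\<exists>C. \<forall>x. norm (f x) \<le> C * norm x" using f by (simp add: dual_space_sel)
  qed
  define Z where "Z = (\<lambda>(a :: 'a, f :: 'a \<Rightarrow> 'k, \<epsilon>). {u. norm (f (a * u - a)) \<le> \<epsilon>})"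
  let ?I = "UNIV \<times> Apre \<times> {0<..} :: ('a \<times> ('a \<Rightarrow> 'k) \<times> real) set"
  have "compactin ?W ?B"
    using self.compactin_wstar_ball[OF self.predual_closed_subspace self.is_dual \<open>0 < r\<close>] by simp
  moreover have "closedin ?W C" if C: "C \<in> Z ` ?I" for C
  proof -
    obtain a f \<epsilon> where f: "f \<in> Apre" and C: "C = Z (a, f, \<epsilon>)" using C by blast
    have "continuous_map ?W euclidean (\<lambda>u. f (a * u))"
      using continuous_map_wstar_functional[OF self.predual_ract[OF f, of a]]
      by (simp add: dual_ract_def)
    then have "continuous_map ?W euclidean (\<lambda>u. norm (f (a * u) - f a))"
      by (intro continuous_map_norm continuous_map_diff) auto
    from closedin_continuous_map_preimage[OF this, of "{..\<epsilon>}"]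
    show ?thesis by (simp add: C Z_def functional(1)[OF f])
  qed
  moreover have "?B \<inter> \<Inter>\<F> \<noteq> {}" if F: "finite \<F>" "\<F> \<subseteq> Z ` ?I" for \<F>
  proof -
    obtain J where J: "finite J" "J \<subseteq> ?I" "\<F> = Z ` J" using F finite_subset_image by metis
    have small: "\<exists>\<delta>>0. \<forall>a u. norm (a * u - a) < \<delta> \<longrightarrow> norm (f (a * u - a)) \<le> \<epsilon>"
      if "f \<in> Apre" "\<epsilon> > 0" for f \<epsilon>
    proof -
      obtain C where "\<forall>x. norm (f x) \<le> C * norm x" using functional(2)[OF \<open>f \<in> Apre\<close>] by blast
      then have C: "norm (f x) \<le> C * norm x" for x by blast
      have "norm (f x) \<le> \<epsilon>" if "norm x < \<epsilon> / (\<bar>C\<bar> + 1)" for x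
      proof -
        have "norm (f x) \<le> (\<bar>C\<bar> + 1) * norm x"
          by (rule order_trans[OF C mult_right_mono]) auto
        also have "\<dots> \<le> \<epsilon>" using that by (simp add: field_simps)
        finally show ?thesis .
      qed
      then show ?thesis using \<open>\<epsilon> > 0\<close>
        by (intro exI[of _ "\<epsilon> / (\<bar>C\<bar> + 1)"]) (auto intro!: divide_pos_pos)
    qed
    have "\<exists>\<delta>>0. \<forall>u. norm (fst j * u - fst j) < \<delta> \<longrightarrow> u \<in> Z j" if "j \<in> J" for j
    proof -
      obtain a f \<epsilon> where j: "j = (a, f, \<epsilon>)" "f \<in> Apre" "\<epsilon> > 0" using J(2) \<open>j \<in> J\<close> by auto
      show ?thesis using small[OF j(2,3)] by (auto simp: j(1) Z_def)
    qed
    then obtain d where "\<forall>j\<in>J. d j > 0 \<and> (\<forall>u. norm (fst j * u - fst j) < d j \<longrightarrow> u \<in> Z j)"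
      using bchoice[of J "\<lambda>j \<delta>. \<delta> > 0 \<and> (\<forall>u. norm (fst j * u - fst j) < \<delta> \<longrightarrow> u \<in> Z j)"] by blast
    then have d: "d j > 0" "norm (fst j * u - fst j) < d j \<Longrightarrow> u \<in> Z j" if "j \<in> J" for j u
      using that by blast+
    define \<delta> where "\<delta> = Min (insert 1 (d ` J))"
    have "\<delta> > 0" using d(1) J(1) by (simp add: \<delta>_def)
    then obtain u where u: "norm u \<le> r" "\<forall>a\<in>fst ` J. norm (a * u - a) < \<delta>"
      using approx[of "fst ` J" \<delta>] J(1) by blast
    have "u \<in> Z j" if "j \<in> J" for j
    proof (rule d(2)[OF that])
      have "\<delta> \<le> d j" using J(1) that by (simp add: \<delta>_def)
      then show "norm (fst j * u - fst j) < d j" using u(2) that by (auto intro: less_le_trans)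
    qed
    then show ?thesis using u(1) J(3) by blast
  qed
  ultimately have "?B \<inter> \<Inter>(Z ` ?I) \<noteq> {}" unfolding compactin_fip by blast
  then obtain e where e: "e \<in> \<Inter>(Z ` ?I)" by blast
  have e: "norm (f (a * e - a)) \<le> \<epsilon>" if "f \<in> Apre" "\<epsilon> > 0" for a f \<epsilon>
  proof -
    have "(a, f, \<epsilon>) \<in> ?I" using that by simp
    then have "e \<in> Z (a, f, \<epsilon>)" using e by (rule INT_D[rotated])
    then show ?thesis by (simp add: Z_def)
  qed
  have "a * e = a" for a
  proof -
    have "f (a * e) = f a" if "f \<in> Apre" for f
    proof -
      have "norm (f (a * e - a)) \<le> 0" by (rule field_le_epsilon) (simp add: e that)
      then show ?thesis by (simp add: functional(1)[OF that])
    qed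
    then have "evaluation Apre (a * e) = evaluation Apre a" by (auto simp: evaluation_def)
    then show ?thesis
      using self.is_dual unfolding is_dual_of_def Let_def bij_betw_def inj_on_def by simp
  qed
  then show ?thesis by blast
qed

theorem theorem2p5:
  fixes smA :: "'k::{real_normed_field, heine_borel} \<Rightarrow> 'a::{real_normed_algebra, banach} \<Rightarrow> 'a"
    and Apre :: "('a \<Rightarrow> 'k) set"
  assumes "dual_banach_algebra smA Apre"
    and "\<And>a b :: 'a. a * b = b * a"
    and "pointwise_Connes_amenable smA Apre"
  shows "\<exists>e::'a. \<forall>a. e * a = a \<and> a * e = a"
proof -
  have "\<exists>e. a * e = a" for a :: 'a
    using pointwise_Connes_amenable_at_imp_unit[OF assms(1)] assms(3)
    by (simp add: pointwise_Connes_amenable_def)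
  from bounded_approximate_joint_unit[OF assms(2) this]
  obtain r where "0 < r"
    and "\<And>S \<delta>. \<lbrakk>finite (S :: 'a set); \<delta> > 0\<rbrakk> \<Longrightarrow> \<exists>u. norm u \<le> r \<and> (\<forall>a\<in>S. norm (a * u - a) < \<delta>)"
    by blast
  then obtain e :: 'a where "\<forall>a. a * e = a"
    using identity_from_bounded_approximate_joint_units[OF assms(1)] by blast
  then show ?thesis using assms(2) by metis
qed

end
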